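(* Let $f:2^\Omega\to\mathbb{R}_{\ge0}$ be a submodular function with $f(\emptyset)=0$ (not necessarily monotone), $X\subseteq\Omega$, $k$ a positive integer, and $\mathrm{OPT}=\max_{C\subseteq X,|C|\le k}f(C)$. Let $\tau=\mathrm{OPT}/(7k)$. Consider the following algorithm: let $S_1$ be the output of the Threshold Algorithm with inputs $(\tau,k)$ run on the elements of $X$; let $S_1'$ be a random subset of $S_1$ containing each element independently with probability $1/2$; let $S_2$ be the output of the Threshold Algorithm with inputs $(\tau,k)$ run on the elements of $X\setminus S_1$; return one of $S_1,S_1',S_2$ chosen uniformly at random. Then the returned set has at most $k$ elements and its expected $f$-value is at least $\mathrm{OPT}/21$.
   Context: A function $f$ is submodular if $f(A)+f(B)\ge f(A\cup B)+f(A\cap B)$ for all $A,B$. The Threshold Algorithm with inputs $(\tau,k)$ processes the elements of a given set in an arbitrary order, maintaining $S$ (initially empty), and adds the current element $e$ to $S$ if $|S|<k$ and $f(S\cup\{e\})-f(S)\ge\tau$. *)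

theory Defs
  imports "HOL-Probability.Probability"
begin

definition submodular_on :: "'a set \<Rightarrow> ('a set \<Rightarrow> real) \<Rightarrow> bool" where
  "submodular_on \<Omega> f \<longleftrightarrow>
     (\<forall>A B. A \<subseteq> \<Omega> \<longrightarrow> B \<subseteq> \<Omega> \<longrightarrow> f A + f B \<ge> f (A \<union> B) + f (A \<inter> B))"

text \<open>Intended for finite \<open>X\<close>: then the maximum is over a finite nonempty set of values, and
  \<open>card C\<close> is the true cardinality of every \<open>C\<close> in the range.\<close>

definition opt_value :: "('a set \<Rightarrow> real) \<Rightarrow> 'a set \<Rightarrow> nat \<Rightarrow> real" where
  "opt_value f X k = Max {f C | C. C \<subseteq> X \<and> card C \<le> k}"

definition threshold_step ::
    "('a set \<Rightarrow> real) \<Rightarrow> real \<Rightarrow> nat \<Rightarrow> 'a set \<Rightarrow> 'a \<Rightarrow> 'a set" where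
  "threshold_step f \<tau> k S e =
     (if card S < k \<and> f (S \<union> {e}) - f S \<ge> \<tau> then S \<union> {e} else S)"

text \<open>The processing order of a set is given by a duplicate-free list enumerating it.\<close>

definition threshold_alg ::
    "('a set \<Rightarrow> real) \<Rightarrow> real \<Rightarrow> nat \<Rightarrow> 'a list \<Rightarrow> 'a set" where
  "threshold_alg f \<tau> k es = foldl (threshold_step f \<tau> k) {} es"

definition enumerates :: "'a list \<Rightarrow> 'a set \<Rightarrow> bool" where
  "enumerates es A \<longleftrightarrow> distinct es \<and> set es = A"

text \<open>\<open>Pi_pmf\<close> makes the coin flips for the elements of \<open>S\<close> independent.\<close>

definition random_half :: "'a set \<Rightarrow> 'a set pmf" where
  "random_half S =
     map_pmf (\<lambda>b. {e \<in> S. b e}) (Pi_pmf S False (\<lambda>_. bernoulli_pmf (1/2)))"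

text \<open>The uniform choice is over the three indices rather than over the set of the three outputs,
  since the outputs may coincide. The list \<open>ys\<close> is meant to enumerate
  \<open>X - threshold_alg f \<tau> k xs\<close> when \<open>xs\<close> enumerates \<open>X\<close>.\<close>

definition two_pass_alg ::
    "('a set \<Rightarrow> real) \<Rightarrow> real \<Rightarrow> nat \<Rightarrow> 'a list \<Rightarrow> 'a list \<Rightarrow> 'a set pmf" where
  "two_pass_alg f \<tau> k xs ys =
     (let S1 = threshold_alg f \<tau> k xs;
          S2 = threshold_alg f \<tau> k ys
      in bind_pmf (random_half S1) (\<lambda>S1'.
           map_pmf (\<lambda>i. [S1, S1', S2] ! i) (pmf_of_set {..<3})))"

end

(* If some pass fills up to k elements, it already has value k * \<tau> = OPT/7.  Otherwise every
   element outside S1 (resp. S2) was rejected for its small marginal gain, so adding the optimal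
   set C to S1, or C - S1 to S2, gains at most OPT/7.  By submodularity and S1 \<inter> S2 = {},
   f (S1 \<union> C) + f (S2 \<union> (C - S1)) \<ge> f (C - S1), while f (C - S1) + f (C \<inter> S1) \<ge> f C.  Finally, the
   uniform random subset of S1 has expected value at least f (C \<inter> S1) / 4. *)
theory Submission imports Defs begin

lemma submodular_onD:
  assumes "submodular_on \<Omega> f" "A \<subseteq> \<Omega>" "B \<subseteq> \<Omega>"
  shows "f (A \<union> B) + f (A \<inter> B) \<le> f A + f B"
  using assms unfolding submodular_on_def by blast

text \<open>Diminishing returns: the submodular inequality for the pair
  \<open>S \<union> {e}\<close> and \<open>T\<close>, rearranged.\<close>

lemma submodular_on_marginal_antimono:
  assumes "submodular_on \<Omega> f" "S \<subseteq> T" "T \<subseteq> \<Omega>" "e \<in> \<Omega>" "e \<notin> T"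
  shows "f (T \<union> {e}) - f T \<le> f (S \<union> {e}) - f S"
proof -
  have "(S \<union> {e}) \<union> T = T \<union> {e}" "(S \<union> {e}) \<inter> T = S"
    using assms by auto
  then show ?thesis
    using submodular_onD[OF assms(1), of "S \<union> {e}" T] assms subset_trans[OF assms(2,3)] by auto
qed

text \<open>Insert the elements of \<open>C\<close> one at a time: by diminishing returns each gains
  at most what it would gain over \<open>S\<close> alone. Elements already in \<open>S\<close> gain
  nothing but are counted in \<open>card C\<close>, which is where \<open>0 \<le> \<tau>\<close>
  enters.\<close>

lemma submodular_on_union_le:
  assumes sub: "submodular_on \<Omega> f" and S: "S \<subseteq> \<Omega>" and C: "finite C" "C \<subseteq> \<Omega>"
    and gain: "\<And>e. e \<in> C - S \<Longrightarrow> f (S \<union> {e}) - f S \<le> \<tau>" and "0 \<le> \<tau>"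
  shows "f (S \<union> C) \<le> f S + real (card C) * \<tau>"
  using C gain
proof (induction C rule: finite_induct)
  case (insert e C)
  then have IH: "f (S \<union> C) \<le> f S + real (card C) * \<tau>" by auto
  have card: "real (card (insert e C)) * \<tau> = real (card C) * \<tau> + \<tau>"
    using insert by (simp add: algebra_simps)
  show ?case
  proof (cases "e \<in> S")
    case True
    then have "S \<union> insert e C = S \<union> C" by auto
    with IH card \<open>0 \<le> \<tau>\<close> show ?thesis by simp
  next
    case False
    have "f ((S \<union> C) \<union> {e}) - f (S \<union> C) \<le> f (S \<union> {e}) - f S"
      by (rule submodular_on_marginal_antimono[OF sub]) (use insert S False in auto)
    moreover have "f (S \<union> {e}) - f S \<le> \<tau>" using insert.prems False by auto
    ultimately show ?thesis using IH card by simp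
  qed
qed simp

lemma threshold_alg_Nil [simp]: "threshold_alg f \<tau> k [] = {}"
  by (simp add: threshold_alg_def)

lemma threshold_alg_snoc [simp]:
  "threshold_alg f \<tau> k (es @ [e]) = threshold_step f \<tau> k (threshold_alg f \<tau> k es) e"
  by (simp add: threshold_alg_def)

lemma threshold_alg_subset: "threshold_alg f \<tau> k es \<subseteq> set es"
  by (induction es rule: rev_induct) (auto simp: threshold_step_def)

lemma finite_threshold_alg [simp]: "finite (threshold_alg f \<tau> k es)"
  using threshold_alg_subset finite_set by (rule finite_subset)

lemma card_threshold_alg_le: "card (threshold_alg f \<tau> k es) \<le> k"
  by (induction es rule: rev_induct) (auto simp: threshold_step_def card_insert_if)

text \<open>The value telescopes from \<open>f {} = 0\<close>, and each accepted element contributes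
  at least \<tau>.\<close>

lemma threshold_alg_value_ge:
  assumes "f {} = 0"
  shows "real (card (threshold_alg f \<tau> k es)) * \<tau> \<le> f (threshold_alg f \<tau> k es)"
  by (induction es rule: rev_induct)
    (auto simp: assms threshold_step_def card_insert_if insert_absorb algebra_simps)

text \<open>A run that ends below \<open>k\<close> elements was below \<open>k\<close> throughout,
  so every refusal was due to a small marginal gain. That gain can only shrink as the set grows
  afterwards.\<close>

lemma threshold_alg_rejected:
  assumes "submodular_on \<Omega> f" "set es \<subseteq> \<Omega>" "card (threshold_alg f \<tau> k es) < k"
    "e \<in> set es - threshold_alg f \<tau> k es"
  shows "f (threshold_alg f \<tau> k es \<union> {e}) - f (threshold_alg f \<tau> k es) < \<tau>"
  using assms(2-)
proof (induction es rule: rev_induct)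
  case (snoc a es)
  let ?S = "threshold_alg f \<tau> k es"
  have sub: "?S \<subseteq> \<Omega>" using threshold_alg_subset snoc.prems by fastforce
  show ?case
  proof (cases "card ?S < k \<and> f (?S \<union> {a}) - f ?S \<ge> \<tau>")
    case True
    then have S': "threshold_alg f \<tau> k (es @ [a]) = ?S \<union> {a}"
      by (simp add: threshold_step_def)
    have e: "e \<in> set es - ?S" "e \<notin> ?S \<union> {a}" using snoc.prems(3) unfolding S' by auto
    have "f (?S \<union> {e}) - f ?S < \<tau>" using snoc True e by auto
    moreover have "f ((?S \<union> {a}) \<union> {e}) - f (?S \<union> {a}) \<le> f (?S \<union> {e}) - f ?S"
      by (rule submodular_on_marginal_antimono[OF assms(1)]) (use snoc.prems sub e in auto)
    ultimately show ?thesis unfolding S' by simp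
  next
    case False
    then have S': "threshold_alg f \<tau> k (es @ [a]) = ?S"
      by (auto simp: threshold_step_def)
    \<comment> \<open>The set did not change, so it is still below \<open>k\<close>: for
      \<open>e = a\<close> the failed test must be the one on the gain, and any other
      \<open>e\<close> falls under the induction hypothesis.\<close>
    show ?thesis using snoc False unfolding S' by (cases "e = a") auto
  qed
qed simp

text \<open>Symmetric difference with a fixed \<open>U\<close> is an involution of
  \<open>Pow S\<close>. In terms of fair coins: flipping those that belong to \<open>U\<close>
  preserves the uniform distribution.\<close>

lemma sum_Pow_sym_diff:
  assumes "U \<subseteq> S"
  shows "(\<Sum>D\<in>Pow S. f (sym_diff D U)) = (\<Sum>D\<in>Pow S. f D)"
  by (rule sum.reindex_bij_witness[of _ "\<lambda>D. sym_diff D U" "\<lambda>D. sym_diff D U"])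
    (use assms in \<open>auto intro!: arg_cong[of _ _ f]\<close>)

text \<open>The sets \<open>D\<close>, \<open>D \<triangle> T\<close>, \<open>D \<triangle> (S - T)\<close> and \<open>S - D\<close> are equidistributed when \<open>D\<close> is, and
  three uses of submodularity bound the sum of their values from below by \<open>f T\<close>.\<close>

lemma expectation_random_half_ge:
  assumes sub: "submodular_on \<Omega> f" and nonneg: "\<And>A. A \<subseteq> \<Omega> \<Longrightarrow> f A \<ge> 0"
    and S: "finite S" "S \<subseteq> \<Omega>" and T: "T \<subseteq> S"
  shows "f T / 4 \<le> measure_pmf.expectation (random_half S) f"
proof -
  define R where "R = S - T"
  have four: "f T \<le> f D + f (sym_diff D T) + f (sym_diff D R) + f (sym_diff D S)"
    if "D \<subseteq> S" for D
  proof -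
    define B B' where "B = D \<inter> R" and "B' = R - D"
    \<comment> \<open>\<open>D\<close> and \<open>sym_diff D T\<close> are complementary inside
      \<open>T\<close> and agree on \<open>R\<close>, where both equal \<open>B\<close>. The second
      pair is likewise complementary inside \<open>T\<close>, and on \<open>R\<close> both equal
      \<open>B'\<close>.\<close>
    have e1: "D \<union> sym_diff D T = T \<union> B" "D \<inter> sym_diff D T = B"
      and e2: "sym_diff D R \<union> sym_diff D S = T \<union> B'" "sym_diff D R \<inter> sym_diff D S = B'"
      and e3: "(T \<union> B) \<union> (T \<union> B') = S" "(T \<union> B) \<inter> (T \<union> B') = T"
      using that T by (auto simp: B_def B'_def R_def)
    have sbs: "D \<subseteq> \<Omega>" "sym_diff D T \<subseteq> \<Omega>" "sym_diff D R \<subseteq> \<Omega>" "sym_diff D S \<subseteq> \<Omega>"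
      "B \<subseteq> \<Omega>" "B' \<subseteq> \<Omega>" "T \<union> B \<subseteq> \<Omega>" "T \<union> B' \<subseteq> \<Omega>"
      using that T S by (auto simp: B_def B'_def R_def)
    \<comment> \<open>On adding the three inequalities the values of \<open>T \<union> B\<close> and
      \<open>T \<union> B'\<close> cancel; those of \<open>B\<close>, \<open>B'\<close> and
      \<open>S\<close> are dropped as nonnegative.\<close>
    show ?thesis
      using submodular_onD[OF sub sbs(1,2), unfolded e1] submodular_onD[OF sub sbs(3,4), unfolded e2]
        submodular_onD[OF sub sbs(7,8), unfolded e3]
        nonneg[OF sbs(5)] nonneg[OF sbs(6)] nonneg[OF S(2)] by linarith
  qed
  have "(\<Sum>D\<in>Pow S. f T)
      \<le> (\<Sum>D\<in>Pow S. f D + f (sym_diff D T) + f (sym_diff D R) + f (sym_diff D S))"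
    by (rule sum_mono) (use four in auto)
  also have "\<dots> = 4 * (\<Sum>D\<in>Pow S. f D)"
    using T by (simp add: sum.distrib sum_Pow_sym_diff R_def)
  finally have "f T * card (Pow S) \<le> 4 * (\<Sum>D\<in>Pow S. f D)"
    by (simp add: mult.commute)
  \<comment> \<open>Independent fair coins give the uniform distribution on
    \<open>Pow S\<close>.\<close>
  moreover have "measure_pmf.expectation (random_half S) f = (\<Sum>D\<in>Pow S. f D) / card (Pow S)"
    using S(1) unfolding random_half_def
    by (subst pmf_of_set_Pow_conv_bernoulli) (auto intro: integral_pmf_of_set)
  moreover have "real (card (Pow S)) > 0" using S(1) by (simp add: card_Pow)
  ultimately show ?thesis by (simp add: pos_le_divide_eq)
qed

lemma set_pmf_random_half:
  assumes "finite S" shows "set_pmf (random_half S) = Pow S"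
  using assms unfolding random_half_def
  by (subst pmf_of_set_Pow_conv_bernoulli) (auto simp: set_pmf_of_set Pow_not_empty)

lemma expectation_uniform_third:
  fixes f :: "'a \<Rightarrow> real"
  shows "measure_pmf.expectation (map_pmf (\<lambda>i. [a, b, c] ! i) (pmf_of_set {..<3})) f
    = (f a + f b + f c) / 3"
proof -
  have "{..<3} = {0, 1, 2::nat}" by auto
  then show ?thesis by (simp add: integral_pmf_of_set)
qed

lemma expectation_two_pass_alg:
  fixes f g :: "'a set \<Rightarrow> real" and \<tau> :: real and k :: nat and xs ys :: "'a list"
  defines "S1 \<equiv> threshold_alg f \<tau> k xs" and "S2 \<equiv> threshold_alg f \<tau> k ys"
  shows "measure_pmf.expectation (two_pass_alg f \<tau> k xs ys) g
    = (g S1 + measure_pmf.expectation (random_half S1) g + g S2) / 3"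
proof -
  have fin: "finite S1" by (simp add: S1_def)
  let ?p = "random_half S1"
  have supp: "set_pmf ?p \<subseteq> Pow S1" and finP: "finite (Pow S1)"
    using fin by (simp_all add: set_pmf_random_half)
  have "measure_pmf.expectation (two_pass_alg f \<tau> k xs ys) g
      = (\<Sum>D\<in>Pow S1. pmf ?p D * ((g S1 + g D + g S2) / 3))"
    unfolding two_pass_alg_def Let_def S1_def[symmetric] S2_def[symmetric]
    by (subst pmf_expectation_bind[OF finP _ supp])
      (simp_all add: expectation_uniform_third set_pmf_of_set lessThan_empty_iff
        del: integral_map_pmf)
  \<comment> \<open>Only the middle summand depends on \<open>D\<close>; the other two are
    multiplied by the total mass 1.\<close>
  also have "\<dots> = ((g S1 + g S2) * (\<Sum>D\<in>Pow S1. pmf ?p D) + (\<Sum>D\<in>Pow S1. pmf ?p D * g D)) / 3"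
    by (simp add: sum_distrib_left sum_divide_distrib sum.distrib[symmetric] algebra_simps
        add_divide_distrib)
  also have "(\<Sum>D\<in>Pow S1. pmf ?p D) = 1"
    by (rule sum_pmf_eq_1[OF finP supp])
  also have "(\<Sum>D\<in>Pow S1. pmf ?p D * g D) = measure_pmf.expectation ?p g"
    by (subst integral_measure_pmf[OF finP]) (use supp in auto)
  finally show ?thesis by simp
qed

text \<open>\<open>Max\<close> is a member of a finite nonempty set: \<open>X\<close> has finitely
  many subsets, and the empty set is always a candidate.\<close>

lemma opt_value_attained:
  assumes "finite X"
  obtains C where "C \<subseteq> X" "card C \<le> k" "f C = opt_value f X k"
proof -
  let ?V = "{f C | C. C \<subseteq> X \<and> card C \<le> k}"
  have "?V \<subseteq> f ` Pow X" by auto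
  then have "finite ?V" using assms by (meson finite_Pow_iff finite_imageI finite_subset)
  moreover have "f {} \<in> ?V" by force
  ultimately have "Max ?V \<in> ?V" by (intro Max_in) auto
  then show thesis using that unfolding opt_value_def by auto
qed

theorem theorem5:
  fixes \<Omega> X :: "'a set" and f :: "'a set \<Rightarrow> real" and k :: nat
    and \<tau> :: real and xs ys :: "'a list"
  assumes "submodular_on \<Omega> f"
    and "\<And>A. A \<subseteq> \<Omega> \<Longrightarrow> f A \<ge> 0"
    and "f {} = 0"
    and "X \<subseteq> \<Omega>" and "finite X"
    and "k > 0"
    and "\<tau> = opt_value f X k / (7 * real k)"
    and "enumerates xs X"
    and "enumerates ys (X - threshold_alg f \<tau> k xs)"
  shows "(\<forall>S \<in> set_pmf (two_pass_alg f \<tau> k xs ys). finite S \<and> card S \<le> k) \<and>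
         measure_pmf.expectation (two_pass_alg f \<tau> k xs ys) f \<ge> opt_value f X k / 21"
proof
  note sub = assms(1) and nonneg = assms(2)
  define S1 S2 where "S1 = threshold_alg f \<tau> k xs" and "S2 = threshold_alg f \<tau> k ys"
  have fin: "finite S1" "finite S2" by (simp_all add: S1_def S2_def)
  have card: "card S1 \<le> k" "card S2 \<le> k"
    by (simp_all add: S1_def S2_def card_threshold_alg_le)
  show "\<forall>S \<in> set_pmf (two_pass_alg f \<tau> k xs ys). finite S \<and> card S \<le> k"
  proof
    fix S assume "S \<in> set_pmf (two_pass_alg f \<tau> k xs ys)"
    then obtain D i where "D \<subseteq> S1" "i < (3::nat)" "S = [S1, D, S2] ! i"
      using fin(1) unfolding two_pass_alg_def Let_def S1_def[symmetric] S2_def[symmetric]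
      by (auto simp: set_pmf_random_half set_pmf_of_set lessThan_empty_iff)
    moreover from this have "S = S1 \<or> S = D \<or> S = S2"
      by (auto simp: less_Suc_eq numeral_3_eq_3)
    ultimately show "finite S \<and> card S \<le> k"
      using fin card card_mono[OF fin(1)] finite_subset[OF _ fin(1)] by (metis order.trans)
  qed

  have xs: "set xs = X" and ys: "set ys = X - S1"
    using assms(8,9) by (auto simp: enumerates_def S1_def)
  have S1: "S1 \<subseteq> X" and S2: "S2 \<subseteq> X - S1"
    using threshold_alg_subset[of f \<tau> k xs] threshold_alg_subset[of f \<tau> k ys] xs ys
    by (simp_all add: S1_def S2_def)
  have sbs: "S1 \<subseteq> \<Omega>" "S2 \<subseteq> \<Omega>" using S1 S2 \<open>X \<subseteq> \<Omega>\<close> by auto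
  obtain C where C: "C \<subseteq> X" "card C \<le> k" "f C = opt_value f X k"
    using opt_value_attained[OF \<open>finite X\<close>] .
  let ?OPT = "opt_value f X k" and ?E = "measure_pmf.expectation (random_half S1) f"
  have finC: "finite C" and C\<Omega>: "C \<subseteq> \<Omega>"
    using C(1) \<open>finite X\<close> \<open>X \<subseteq> \<Omega>\<close> by (auto intro: finite_subset)
  have OPT: "?OPT \<ge> 0" using nonneg[OF C\<Omega>] C(3) by simp
  have \<tau>: "\<tau> \<ge> 0" "real k * \<tau> = ?OPT / 7"
    using OPT \<open>k > 0\<close> by (simp_all add: assms(7))
  have half: "f T / 4 \<le> ?E" if "T \<subseteq> S1" for T
    using expectation_random_half_ge[OF sub nonneg fin(1) sbs(1) that] by simp
  \<comment> \<open>The quarter bound with \<open>T = {}\<close> already gives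
    nonnegativity.\<close>
  have E: "?E \<ge> 0" using half[of "{}"] assms(3) by simp
  have pos: "f S1 \<ge> 0" "f S2 \<ge> 0" using nonneg sbs by auto
  have val: "real (card S1) * \<tau> \<le> f S1" "real (card S2) * \<tau> \<le> f S2"
    by (simp_all add: S1_def S2_def threshold_alg_value_ge assms(3))
  \<comment> \<open>The uniform choice among three outputs divides this sum by 3, which turns 7 into
    21.\<close>
  have "?OPT / 7 \<le> f S1 + ?E + f S2"
  proof (cases "card S1 = k \<or> card S2 = k")
    case True
    then show ?thesis using val \<tau>(2) pos E by auto
  next
    case False
    with card have less: "card S1 < k" "card S2 < k" by auto
    have rej1: "f (S1 \<union> {e}) - f S1 \<le> \<tau>" if "e \<in> C - S1" for e
      using threshold_alg_rejected[OF sub, of xs \<tau> k e] less that xs C(1) \<open>X \<subseteq> \<Omega>\<close>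
      by (force simp: S1_def)
    \<comment> \<open>The second pass sees all of \<open>C - S1\<close>, since \<open>ys\<close>
      enumerates \<open>X - S1\<close>.\<close>
    have rej2: "f (S2 \<union> {e}) - f S2 \<le> \<tau>" if "e \<in> (C - S1) - S2" for e
      using threshold_alg_rejected[OF sub, of ys \<tau> k e] less that ys C(1) \<open>X \<subseteq> \<Omega>\<close>
      by (force simp: S2_def)
    have "card (C - S1) \<le> k"
      using card_mono[OF finC, of "C - S1"] C(2) by auto
    then have gain: "real (card C) * \<tau> \<le> ?OPT / 7" "real (card (C - S1)) * \<tau> \<le> ?OPT / 7"
      using C(2) \<tau> mult_right_mono[of "real (card _)" "real k" \<tau>] by (metis of_nat_le_iff)+
    have "f (S1 \<union> C) \<le> f S1 + real (card C) * \<tau>"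
      by (rule submodular_on_union_le[OF sub sbs(1) finC C\<Omega> rej1 \<tau>(1)])
    moreover have "f (S2 \<union> (C - S1)) \<le> f S2 + real (card (C - S1)) * \<tau>"
      by (rule submodular_on_union_le[OF sub sbs(2) _ _ rej2 \<tau>(1)]) (use finC C\<Omega> in auto)
    moreover have "f (C - S1) \<le> f (S1 \<union> C) + f (S2 \<union> (C - S1))"
    proof -
      \<comment> \<open>Because \<open>S2\<close> avoids \<open>S1\<close>, the two enlarged sets
        meet exactly in \<open>C - S1\<close>; the value of their union is dropped as
        nonnegative.\<close>
      have "(S1 \<union> C) \<inter> (S2 \<union> (C - S1)) = C - S1" "C - S1 \<subseteq> \<Omega>" using S2 C\<Omega> by auto
      then show ?thesis
        using submodular_onD[OF sub, of "S1 \<union> C" "S2 \<union> (C - S1)"]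
          nonneg[of "(S1 \<union> C) \<union> (S2 \<union> (C - S1))"] sbs C\<Omega> by auto
    qed
    moreover have "f C \<le> f (C - S1) + f (C \<inter> S1)"
    proof -
      have "(C - S1) \<union> (C \<inter> S1) = C" "(C - S1) \<inter> (C \<inter> S1) = {}" by auto
      then show ?thesis
        using submodular_onD[OF sub, of "C - S1" "C \<inter> S1"] C\<Omega> assms(3) by auto
    qed
    moreover have "f (C \<inter> S1) / 4 \<le> ?E" by (rule half) simp
    \<comment> \<open>Chaining gives OPT <= f S1 + f S2 + 4 E + 2 OPT/7. Hence 5 OPT/7 is at most 4
      times the required sum, which is therefore at least 5 OPT/28 >= OPT/7.\<close>
    ultimately show ?thesis using gain C(3) pos OPT by linarith
  qed
  then show "measure_pmf.expectation (two_pass_alg f \<tau> k xs ys) f \<ge> ?OPT / 21"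
    by (simp add: expectation_two_pass_alg S1_def[symmetric] S2_def[symmetric])
qed

end
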